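(* Let $M$ be a matroid of rank $r$ on a finite set $E$, and let $P_{\mathcal F(M)}$ be the polytope of its truncation flag matroid. Then, as a signed Minkowski sum, \[P_{\mathcal F(M)}=\sum_{I\subseteq E}\widetilde\gamma(M/I)\,\Delta_{E-I},\] i.e. $P_{\mathcal F(M)}+\sum_{I:\,\widetilde\gamma(M/I)<0}(-\widetilde\gamma(M/I))\Delta_{E-I}=\sum_{I:\,\widetilde\gamma(M/I)>0}\widetilde\gamma(M/I)\Delta_{E-I}$.
   Context: For $1\le i\le r$, the rank-$i$ truncation $M_i$ of $M$ is the matroid on $E$ whose bases are the independent sets of $M$ of size $i$. The truncation flag matroid $\mathcal F(M)$ is the set of flags $B=(B_1,\dots,B_r)$ with $B_i$ a basis of $M_i$ and $B_1\subset B_2\subset\cdots\subset B_r$. For such a flag let $v_B=v_{B_1}+\cdots+v_{B_r}$, where $v_S=\sum_{a\in S}e_a\in\mathbb{R}^E$; then $P_{\mathcal F(M)}=\mathrm{conv}\{v_B: B\in\mathcal F(M)\}$. For nonempty $J\subseteq E$, $\Delta_J=\mathrm{conv}\{e_i:i\in J\}$. For $I\subseteq E$, $M/I$ is the contraction with rank function $r_{M/I}(X)=r(X\cup I)-r(I)$. For a matroid $N$ with Tutte polynomial $T_N(x,y)=\sum_{A}(x-1)^{r_N(S)-r_N(A)}(y-1)^{|A|-r_N(A)}=\sum b_{ij}x^iy^j$, the gamma invariant is $\gamma(N)=b_{20}-b_{10}$ and the signed gamma invariant is $\widetilde\gamma(N)=(-1)^{r_N(S)}\gamma(N)$, where $S$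 is the ground set of $N$. Minkowski sum $P+Q=\{p+q\}$, $yQ=\{yq\}$ for $y\ge0$. *)

theory Defs
  imports "HOL-Analysis.Analysis" "HOL-Computational_Algebra.Polynomial"
begin

text \<open>
  A matroid is given by its finite ground set \<open>E\<close> and its rank function \<open>rk\<close>, subject to the usual
  rank axioms. Values of \<open>rk\<close> on sets that are not contained in \<open>E\<close> are irrelevant.
\<close>

definition matroid :: "'a set \<Rightarrow> ('a set \<Rightarrow> nat) \<Rightarrow> bool" where
  "matroid E rk \<longleftrightarrow>
     finite E \<and>
     (\<forall>X. X \<subseteq> E \<longrightarrow> rk X \<le> card X) \<and>
     (\<forall>X Y. X \<subseteq> Y \<and> Y \<subseteq> E \<longrightarrow> rk X \<le> rk Y) \<and>
     (\<forall>X Y. X \<subseteq> E \<and> Y \<subseteq> E \<longrightarrow> rk (X \<union> Y) + rk (X \<inter> Y) \<le> rk X + rk Y)"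

definition indep :: "'a set \<Rightarrow> ('a set \<Rightarrow> nat) \<Rightarrow> 'a set \<Rightarrow> bool" where
  "indep E rk X \<longleftrightarrow> X \<subseteq> E \<and> rk X = card X"

definition truncation_bases :: "'a set \<Rightarrow> ('a set \<Rightarrow> nat) \<Rightarrow> nat \<Rightarrow> 'a set set" where
  "truncation_bases E rk i = {B. indep E rk B \<and> card B = i}"

text \<open>A flag \<open>(B\<^sub>1, \<dots>, B\<^sub>r)\<close> is a list, so that \<open>B\<^sub>i\<close> is the entry with index \<open>i - 1\<close>.\<close>

definition truncation_flags :: "'a set \<Rightarrow> ('a set \<Rightarrow> nat) \<Rightarrow> 'a set list set" where
  "truncation_flags E rk =
     {B. length B = rk E \<and>
         (\<forall>i\<in>{1..rk E}. B ! (i - 1) \<in> truncation_bases E rk i) \<and>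
         sorted_wrt (\<subset>) B}"

text \<open>
  The space \<open>\<real>\<^sup>E\<close> is the coordinate subspace of \<open>real ^ 'a\<close> spanned by the vectors \<open>axis a 1\<close>
  with \<open>a \<in> E\<close>, where \<open>'a\<close> is any finite type containing the ground set.
\<close>

definition set_vec :: "'a::finite set \<Rightarrow> real ^ 'a" where
  "set_vec S = (\<Sum>a\<in>S. axis a 1)"

definition flag_vec :: "'a::finite set list \<Rightarrow> real ^ 'a" where
  "flag_vec B = (\<Sum>S\<leftarrow>B. set_vec S)"

definition flag_polytope :: "'a::finite set \<Rightarrow> ('a set \<Rightarrow> nat) \<Rightarrow> (real ^ 'a) set" where
  "flag_polytope E rk = convex hull (flag_vec ` truncation_flags E rk)"

definition simplex_on :: "'a::finite set \<Rightarrow> (real ^ 'a) set" where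
  "simplex_on J = convex hull ((\<lambda>i. axis i 1) ` J)"

text \<open>Rank function of \<open>M/I\<close>, whose ground set is \<open>E - I\<close>.\<close>

definition contract_rank :: "('a set \<Rightarrow> nat) \<Rightarrow> 'a set \<Rightarrow> 'a set \<Rightarrow> nat" where
  "contract_rank rk I X = rk (X \<union> I) - rk I"

lemma matroid_contract:
  assumes "matroid E rk" "I \<subseteq> E"
  shows "matroid (E - I) (contract_rank rk I)"
proof -
  have fin: "finite E" and card: "\<And>X. X \<subseteq> E \<Longrightarrow> rk X \<le> card X"
    and mono: "\<And>X Y. X \<subseteq> Y \<Longrightarrow> Y \<subseteq> E \<Longrightarrow> rk X \<le> rk Y"
    and submod: "\<And>X Y. X \<subseteq> E \<Longrightarrow> Y \<subseteq> E \<Longrightarrow> rk (X \<union> Y) + rk (X \<inter> Y) \<le> rk X + rk Y"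
    using assms(1) unfolding matroid_def by blast+
  have "contract_rank rk I X \<le> card X" if "X \<subseteq> E - I" for X
  proof -
    have "X \<subseteq> E" using that by blast
    then show ?thesis
      using submod[of X I] card[of X] assms(2) unfolding contract_rank_def by linarith
  qed
  moreover have "contract_rank rk I X \<le> contract_rank rk I Y" if "X \<subseteq> Y" "Y \<subseteq> E - I" for X Y
  proof -
    have "X \<union> I \<subseteq> Y \<union> I" "Y \<union> I \<subseteq> E" using that assms(2) by blast+
    then show ?thesis
      using mono[of "X \<union> I" "Y \<union> I"] unfolding contract_rank_def by linarith
  qed
  moreover have "contract_rank rk I (X \<union> Y) + contract_rank rk I (X \<inter> Y)
      \<le> contract_rank rk I X + contract_rank rk I Y" if "X \<subseteq> E - I" "Y \<subseteq> E - I" for X Y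
  proof -
    have sub: "X \<union> I \<subseteq> E" "Y \<union> I \<subseteq> E" "X \<union> Y \<union> I \<subseteq> E" "X \<inter> Y \<union> I \<subseteq> E"
      using that assms(2) by blast+
    have eq: "(X \<union> I) \<union> (Y \<union> I) = X \<union> Y \<union> I" "(X \<union> I) \<inter> (Y \<union> I) = X \<inter> Y \<union> I"
      by blast+
    have "rk (X \<union> Y \<union> I) + rk (X \<inter> Y \<union> I) \<le> rk (X \<union> I) + rk (Y \<union> I)"
      using submod[OF sub(1,2)] unfolding eq .
    moreover have "rk I \<le> rk (X \<union> Y \<union> I)" "rk I \<le> rk (X \<inter> Y \<union> I)"
        "rk I \<le> rk (X \<union> I)" "rk I \<le> rk (Y \<union> I)"
      by (rule mono[OF Un_upper2 sub(3)] mono[OF Un_upper2 sub(4)]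
               mono[OF Un_upper2 sub(1)] mono[OF Un_upper2 sub(2)])+
    ultimately show ?thesis
      unfolding contract_rank_def by linarith
  qed
  ultimately show ?thesis using fin unfolding matroid_def by simp
qed

text \<open>
  Bivariate polynomials are polynomials in \<open>y\<close> whose coefficients are polynomials in \<open>x\<close>; thus the
  coefficient of \<open>x\<^sup>i y\<^sup>j\<close> in \<open>T\<close> is \<open>coeff (coeff T j) i\<close>.
\<close>

definition var_x :: "int poly poly" where
  "var_x = [:[:0, 1:]:]"

definition var_y :: "int poly poly" where
  "var_y = [:0, 1:]"

definition tutte :: "'a set \<Rightarrow> ('a set \<Rightarrow> nat) \<Rightarrow> int poly poly" where
  "tutte S rk = (\<Sum>A\<in>Pow S. (var_x - 1) ^ (rk S - rk A) * (var_y - 1) ^ (card A - rk A))"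

definition tutte_coeff :: "'a set \<Rightarrow> ('a set \<Rightarrow> nat) \<Rightarrow> nat \<Rightarrow> nat \<Rightarrow> int" where
  "tutte_coeff S rk i j = coeff (coeff (tutte S rk) j) i"

definition gamma_inv :: "'a set \<Rightarrow> ('a set \<Rightarrow> nat) \<Rightarrow> int" where
  "gamma_inv S rk = tutte_coeff S rk 2 0 - tutte_coeff S rk 1 0"

definition signed_gamma :: "'a set \<Rightarrow> ('a set \<Rightarrow> nat) \<Rightarrow> int" where
  "signed_gamma S rk = (-1) ^ rk S * gamma_inv S rk"

definition signed_gamma_contract :: "'a set \<Rightarrow> ('a set \<Rightarrow> nat) \<Rightarrow> 'a set \<Rightarrow> int" where
  "signed_gamma_contract E rk I = signed_gamma (E - I) (contract_rank rk I)"

end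

theory Submission
  imports Defs
begin

text \<open>
  Both sides are generalized permutohedra: polytopes in which the maxima \<open>f S\<close> of the functionals
  \<open>\<Sum>a\<in>S. x $ a\<close> are attained simultaneously along every chain of subsets of \<open>E\<close>. Such a polytope is
  determined by \<open>f\<close>, and \<open>f\<close> is additive under Minkowski sums. For the flag polytope
  \<open>f S = (\<Sum>i=1..r. min i (rk S))\<close>, that is, \<open>f E - f S\<close> is the binomial coefficient of
  \<open>r - rk S + 1\<close> over 2; for \<open>\<Delta>\<^sub>J\<close> it is the indicator of \<open>S \<inter> J \<noteq> {}\<close>. Reading the coefficients off the
  Tutte polynomial shows that the signed gamma invariant of \<open>M/I\<close> is the alternating sum of these
  binomial coefficients over the supersets of \<open>I\<close>, so the claim is a Moebius inversion.
\<close>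

section \<open>Generalized permutohedra\<close>

text \<open>One witness for a whole chain replaces submodularity: the chain consisting of
  \<open>S \<inter> T\<close> and \<open>S \<union> T\<close> gives back the submodular inequality
  for \<open>f\<close>. The empty chain makes \<open>P\<close> nonempty.\<close>

definition gen_permutohedron :: "'a::finite set \<Rightarrow> ('a set \<Rightarrow> real) \<Rightarrow> (real ^ 'a) set \<Rightarrow> bool" where
  "gen_permutohedron E f P \<longleftrightarrow>
     compact P \<and> convex P \<and>
     (\<forall>x\<in>P. (\<forall>S\<subseteq>E. (\<Sum>a\<in>S. x $ a) \<le> f S) \<and> (\<Sum>a\<in>E. x $ a) = f E \<and> (\<forall>a. a \<notin> E \<longrightarrow> x $ a = 0)) \<and>
     (\<forall>C. subset.chain (Pow E) C \<longrightarrow> (\<exists>x\<in>P. \<forall>S\<in>C. (\<Sum>a\<in>S. x $ a) = f S))"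

lemma gen_permutohedron_cong:
  assumes "\<And>S. S \<subseteq> E \<Longrightarrow> f S = g S" "gen_permutohedron E f P"
  shows "gen_permutohedron E g P"
proof -
  have "f S = g S" if "S \<in> C" "subset.chain (Pow E) C" for S C
    using that assms(1) by (auto simp: subset_chain_def)
  then show ?thesis
    using assms unfolding gen_permutohedron_def by (metis order_refl)
qed

text \<open>Abel summation: \<open>w - m\<close> is a nonnegative combination of indicators of the
  upper level sets of \<open>w\<close>, which are the sets \<open>S\<close> in the second
  hypothesis. The induction peels off the lowest level.\<close>

lemma weighted_sum_nonneg_if_upper_sums_nonneg:
  fixes w d :: "'a \<Rightarrow> real"
  assumes "finite E"
    and "\<And>S. S \<subseteq> E \<Longrightarrow> (\<And>a b. a \<in> S \<Longrightarrow> b \<in> E - S \<Longrightarrow> w b < w a) \<Longrightarrow> sum d S \<ge> 0"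
    and "\<And>a. a \<in> E \<Longrightarrow> m \<le> w a"
  shows "(\<Sum>a\<in>E. (w a - m) * d a) \<ge> 0"
  using assms
proof (induction E arbitrary: m rule: finite_psubset_induct)
  case (psubset E)
  show ?case
  proof (cases "E = {}")
    case False
    define m' where "m' = Min (w ` E)"
    define E' where "E' = {a\<in>E. m' < w a}"
    have m'_le: "m' \<le> w a" if "a \<in> E" for a
      using that psubset.hyps by (simp add: m'_def)
    have "m' \<in> w ` E"
      unfolding m'_def using False psubset.hyps by simp
    then obtain a0 where a0: "a0 \<in> E" "w a0 = m'" by auto
    have "E' \<subset> E" using a0 by (auto simp: E'_def)
    have "0 \<le> (\<Sum>a\<in>E'. (w a - m') * d a)"
    proof (rule psubset.IH[OF \<open>E' \<subset> E\<close>])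
      fix S assume S: "S \<subseteq> E'" "\<And>a b. a \<in> S \<Longrightarrow> b \<in> E' - S \<Longrightarrow> w b < w a"
      show "0 \<le> sum d S"
      proof (rule psubset.prems(1))
        show "S \<subseteq> E" using S \<open>E' \<subset> E\<close> by blast
        fix a b assume "a \<in> S" "b \<in> E - S"
        \<comment> \<open>An element of \<open>E\<close> outside \<open>E'\<close> has the minimal
          weight \<open>m'\<close>, so an upper level set of \<open>E'\<close> is also one of
          \<open>E\<close>.\<close>
        then show "w b < w a"
          using S m'_le[of b] by (cases "b \<in> E'") (auto simp: E'_def)
      qed
    qed (auto simp: E'_def)
    also have "(\<Sum>a\<in>E'. (w a - m') * d a) = (\<Sum>a\<in>E. (w a - m') * d a)"
      using psubset.hyps m'_le by (intro sum.mono_neutral_left) (auto simp: E'_def less_le)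
    finally have "0 \<le> (\<Sum>a\<in>E. (w a - m') * d a)" .
    \<comment> \<open>\<open>E\<close> itself is an upper level set, vacuously.\<close>
    moreover have "0 \<le> (m' - m) * sum d E"
      using psubset.prems(1)[of E] psubset.prems(2)[OF a0(1)] a0(2) by simp
    moreover have "(\<Sum>a\<in>E. (w a - m) * d a) = (\<Sum>a\<in>E. (w a - m') * d a) + (m' - m) * sum d E"
      by (simp add: sum_distrib_left algebra_simps flip: sum.distrib sum_subtractf)
    ultimately show ?thesis by linarith
  qed simp
qed

text \<open>A point \<open>y\<close> of \<open>P\<close> outside \<open>Q\<close> is separated from
  \<open>Q\<close> by a functional. Its level sets form a chain, on which some \<open>x\<close> in
  \<open>Q\<close> attains \<open>f\<close>. As \<open>y\<close> obeys the bounds \<open>f\<close>,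
  Abel summation puts \<open>x\<close> at least as far as \<open>y\<close> in the separating
  direction, a contradiction.\<close>

lemma gen_permutohedron_subset:
  assumes P: "gen_permutohedron E f P" and Q: "gen_permutohedron E f Q"
  shows "P \<subseteq> Q"
proof
  fix y assume "y \<in> P"
  show "y \<in> Q"
  proof (rule ccontr)
    assume "y \<notin> Q"
    have "convex Q" "closed Q"
      using Q compact_imp_closed by (auto simp: gen_permutohedron_def)
    then obtain u b where ub: "u \<bullet> y < b" "\<And>x. x \<in> Q \<Longrightarrow> b < u \<bullet> x"
      using separating_hyperplane_closed_point \<open>y \<notin> Q\<close> by metis
    \<comment> \<open>The sign is reversed because the separation places \<open>y\<close> on the low
      side of \<open>u\<close>, while \<open>f\<close> bounds sums from above.\<close>
    define w where "w a = - u $ a" for a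
    define C where "C = {S. S \<subseteq> E \<and> (\<forall>a\<in>S. \<forall>b\<in>E - S. w b < w a)}"
    have "subset.chain (Pow E) C"
      unfolding subset_chain_def
    proof (intro conjI ballI)
      show "C \<subseteq> Pow E" by (auto simp: C_def)
      fix S T assume "S \<in> C" "T \<in> C"
      then have "w b < w a \<and> w a < w b" if "a \<in> S - T" "b \<in> T - S" for a b
        using that by (auto simp: C_def)
      then show "S \<subseteq> T \<or> T \<subseteq> S" by (meson DiffI less_asym subsetI)
    qed
    then have "\<exists>x\<in>Q. \<forall>S\<in>C. (\<Sum>a\<in>S. x $ a) = f S"
      using Q by (simp add: gen_permutohedron_def)
    then obtain x where x: "x \<in> Q" "\<And>S. S \<in> C \<Longrightarrow> (\<Sum>a\<in>S. x $ a) = f S" by blast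
    define d where "d a = x $ a - y $ a" for a
    \<comment> \<open>The weights may be negative, so they are shifted by their minimum; the shift
      costs nothing because \<open>sum d E = 0\<close>.\<close>
    have "0 \<le> (\<Sum>a\<in>E. (w a - Min (w ` E)) * d a)"
    proof (rule weighted_sum_nonneg_if_upper_sums_nonneg)
      fix S assume "S \<subseteq> E" "\<And>a b. a \<in> S \<Longrightarrow> b \<in> E - S \<Longrightarrow> w b < w a"
      then have "S \<in> C" by (simp add: C_def)
      then show "0 \<le> sum d S"
        using x(2) P \<open>y \<in> P\<close> \<open>S \<subseteq> E\<close> by (simp add: d_def sum_subtractf gen_permutohedron_def)
    qed auto
    also have "\<dots> = (\<Sum>a\<in>E. w a * d a) - Min (w ` E) * sum d E"
      by (simp add: left_diff_distrib sum_subtractf sum_distrib_left)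
    also have "sum d E = 0"
      using P Q \<open>x \<in> Q\<close> \<open>y \<in> P\<close> by (simp add: d_def sum_subtractf gen_permutohedron_def)
    also have "(\<Sum>a\<in>E. w a * d a) = (\<Sum>a\<in>UNIV. w a * d a)"
      using P Q \<open>x \<in> Q\<close> \<open>y \<in> P\<close>
      by (intro sum.mono_neutral_left) (auto simp: d_def gen_permutohedron_def)
    also have "\<dots> = u \<bullet> y - u \<bullet> x"
      by (simp add: inner_vec_def w_def d_def right_diff_distrib flip: sum_subtractf)
    finally show False using ub(1) ub(2)[OF x(1)] by simp
  qed
qed

lemma gen_permutohedron_unique:
  "gen_permutohedron E f P \<Longrightarrow> gen_permutohedron E f Q \<Longrightarrow> P = Q"
  by (simp add: gen_permutohedron_subset subset_antisym)

section \<open>Minkowski sums, dilations and convex hulls\<close>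

lemma gen_permutohedron_zero: "gen_permutohedron E (\<lambda>S. 0) {0}"
  by (simp add: gen_permutohedron_def)

lemma gen_permutohedron_plus:
  assumes P: "gen_permutohedron E f P" and Q: "gen_permutohedron E g Q"
  shows "gen_permutohedron E (\<lambda>S. f S + g S) (P + Q)"
  unfolding gen_permutohedron_def
proof (intro conjI ballI allI impI)
  have "P + Q = {x + y |x y. x \<in> P \<and> y \<in> Q}"
    by (auto simp: set_plus_def)
  then show "compact (P + Q)"
    using P Q compact_sums[of P Q] by (simp add: gen_permutohedron_def)
  show "convex (P + Q)"
    using P Q by (simp add: gen_permutohedron_def convex_set_plus)
next
  fix z S assume "z \<in> P + Q" "S \<subseteq> E"
  then show "(\<Sum>a\<in>S. z $ a) \<le> f S + g S"
    using P Q by (auto simp: gen_permutohedron_def sum.distrib add_mono elim!: set_plus_elim)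
next
  fix z assume "z \<in> P + Q"
  then show "(\<Sum>a\<in>E. z $ a) = f E + g E"
    using P Q by (auto simp: gen_permutohedron_def sum.distrib elim!: set_plus_elim)
next
  fix z a assume "z \<in> P + Q" "a \<notin> E"
  then show "z $ a = 0"
    using P Q by (auto simp: gen_permutohedron_def elim!: set_plus_elim)
next
  fix C assume "subset.chain (Pow E) C"
  then obtain x y where "x \<in> P" "\<forall>S\<in>C. (\<Sum>a\<in>S. x $ a) = f S" "y \<in> Q" "\<forall>S\<in>C. (\<Sum>a\<in>S. y $ a) = g S"
    using P Q unfolding gen_permutohedron_def by meson
  then show "\<exists>z\<in>P + Q. \<forall>S\<in>C. (\<Sum>a\<in>S. z $ a) = f S + g S"
    by (intro bexI[of _ "x + y"]) (auto simp: sum.distrib)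
qed

lemma gen_permutohedron_sum:
  assumes "finite A" "\<And>i. i \<in> A \<Longrightarrow> gen_permutohedron E (f i) (P i)"
  shows "gen_permutohedron E (\<lambda>S. \<Sum>i\<in>A. f i S) (\<Sum>i\<in>A. P i)"
  using assms
  by (induction A rule: finite_induct) (simp_all add: gen_permutohedron_zero gen_permutohedron_plus)

lemma gen_permutohedron_scale:
  assumes P: "gen_permutohedron E f P" and "0 \<le> c"
  shows "gen_permutohedron E (\<lambda>S. c * f S) ((\<lambda>x. c *\<^sub>R x) ` P)"
  unfolding gen_permutohedron_def
proof (intro conjI ballI allI impI)
  show "compact ((\<lambda>x. c *\<^sub>R x) ` P)" "convex ((\<lambda>x. c *\<^sub>R x) ` P)"
    using P by (simp_all add: gen_permutohedron_def compact_scaling convex_scaling)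
next
  fix z S assume "z \<in> (\<lambda>x. c *\<^sub>R x) ` P" "S \<subseteq> E"
  then show "(\<Sum>a\<in>S. z $ a) \<le> c * f S"
    using P \<open>0 \<le> c\<close> by (auto simp: gen_permutohedron_def mult_left_mono simp flip: sum_distrib_left)
next
  fix z assume "z \<in> (\<lambda>x. c *\<^sub>R x) ` P"
  then show "(\<Sum>a\<in>E. z $ a) = c * f E"
    using P by (auto simp: gen_permutohedron_def simp flip: sum_distrib_left)
next
  fix z a assume "z \<in> (\<lambda>x. c *\<^sub>R x) ` P" "a \<notin> E"
  then show "z $ a = 0"
    using P by (auto simp: gen_permutohedron_def)
next
  fix C assume "subset.chain (Pow E) C"
  then obtain x where "x \<in> P" "\<forall>S\<in>C. (\<Sum>a\<in>S. x $ a) = f S"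
    using P unfolding gen_permutohedron_def by meson
  then show "\<exists>z\<in>(\<lambda>x. c *\<^sub>R x) ` P. \<forall>S\<in>C. (\<Sum>a\<in>S. z $ a) = c * f S"
    by (intro bexI[of _ "c *\<^sub>R x"]) (auto simp flip: sum_distrib_left)
qed

text \<open>The bounds cut out a convex set \<open>H\<close>, so they pass from \<open>V\<close> to
  its hull, while tight points can already be found in \<open>V\<close>.\<close>

lemma gen_permutohedron_convex_hull:
  fixes V :: "(real ^ 'a::finite) set"
  assumes "finite V"
    and "\<And>x S. x \<in> V \<Longrightarrow> S \<subseteq> E \<Longrightarrow> (\<Sum>a\<in>S. x $ a) \<le> f S"
    and "\<And>x. x \<in> V \<Longrightarrow> (\<Sum>a\<in>E. x $ a) = f E"
    and "\<And>x a. x \<in> V \<Longrightarrow> a \<notin> E \<Longrightarrow> x $ a = 0"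
    and "\<And>C. subset.chain (Pow E) C \<Longrightarrow> \<exists>x\<in>V. \<forall>S\<in>C. (\<Sum>a\<in>S. x $ a) = f S"
  shows "gen_permutohedron E f (convex hull V)"
proof -
  define H where "H = {x :: real ^ 'a. (\<forall>S\<subseteq>E. (\<Sum>a\<in>S. x $ a) \<le> f S) \<and>
    (\<Sum>a\<in>E. x $ a) = f E \<and> (\<forall>a. a \<notin> E \<longrightarrow> x $ a = 0)}"
  have "convex H"
    unfolding convex_def
  proof (intro ballI allI impI)
    fix x y :: "real ^ 'a" and u v :: real
    assume x: "x \<in> H" and y: "y \<in> H" and uv: "0 \<le> u" "0 \<le> v" "u + v = 1"
    have eq: "(\<Sum>a\<in>S. (u *\<^sub>R x + v *\<^sub>R y) $ a) = u * (\<Sum>a\<in>S. x $ a) + v * (\<Sum>a\<in>S. y $ a)" for S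
      by (simp add: sum.distrib sum_distrib_left)
    have "u * (\<Sum>a\<in>S. x $ a) + v * (\<Sum>a\<in>S. y $ a) \<le> f S" if "S \<subseteq> E" for S
      using x y uv that by (intro convex_bound_le) (auto simp: H_def)
    moreover have "u * f E + v * f E = f E"
      using uv(3) by (metis distrib_right mult_1)
    ultimately show "u *\<^sub>R x + v *\<^sub>R y \<in> H"
      using x y unfolding H_def mem_Collect_eq eq by simp
  qed
  moreover have "V \<subseteq> H"
    using assms(2-4) by (auto simp: H_def)
  ultimately have "convex hull V \<subseteq> H"
    by (simp add: hull_minimal)
  moreover have "\<exists>x\<in>convex hull V. \<forall>S\<in>C. (\<Sum>a\<in>S. x $ a) = f S" if "subset.chain (Pow E) C" for C
    using assms(5)[OF that] hull_subset[of V convex] by blast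
  ultimately show ?thesis
    using assms(1) unfolding gen_permutohedron_def H_def
    by (simp add: subset_iff finite_imp_compact_convex_hull)
qed

text \<open>The nonempty traces on \<open>J\<close> of the members of a chain form a chain again.
  Any \<open>j\<close> in the least trace gives a vertex that is tight for the whole chain.\<close>

lemma gen_permutohedron_simplex_on:
  fixes J :: "'a::finite set"
  assumes "J \<subseteq> E" "J \<noteq> {}"
  shows "gen_permutohedron E (\<lambda>S. of_bool (S \<inter> J \<noteq> {})) (simplex_on J)"
proof -
  have sum_axis: "(\<Sum>a\<in>S. (axis j 1 :: real ^ 'a) $ a) = of_bool (j \<in> S)" for S and j :: 'a
    by (simp add: axis_def)
  show ?thesis
    unfolding simplex_on_def
  proof (rule gen_permutohedron_convex_hull)
    fix C assume C: "subset.chain (Pow E) C"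
    \<comment> \<open>Inserting \<open>J\<close> keeps \<open>D\<close> nonempty and forces
      \<open>j \<in> J\<close>, even if no member of \<open>C\<close> meets
      \<open>J\<close>.\<close>
    define D where "D = insert J ((\<lambda>S. S \<inter> J) ` {S\<in>C. S \<inter> J \<noteq> {}})"
    have "subset.chain UNIV D"
      using C unfolding D_def subset_chain_def by fast
    then have "\<Inter>D \<in> D"
      by (intro Inter_in_chain) (auto simp: D_def)
    moreover have "{} \<notin> D" using assms(2) by (auto simp: D_def)
    ultimately obtain j where j: "j \<in> \<Inter>D" by (metis all_not_in_conv)
    then have "j \<in> J" by (simp add: D_def)
    moreover have "j \<in> S \<longleftrightarrow> S \<inter> J \<noteq> {}" if "S \<in> C" for S
      using j that \<open>j \<in> J\<close> unfolding D_def by blast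
    ultimately show "\<exists>x\<in>(\<lambda>i. axis i 1) ` J. \<forall>S\<in>C. (\<Sum>a\<in>S. x $ a) = (of_bool (S \<inter> J \<noteq> {}) :: real)"
      by (auto simp: sum_axis)
  qed (use assms in \<open>auto simp: sum_axis, auto simp: axis_def split: if_splits\<close>)
qed

section \<open>The flag polytope\<close>

lemma matroid_rank_le_card: "matroid E rk \<Longrightarrow> X \<subseteq> E \<Longrightarrow> rk X \<le> card X"
  by (simp add: matroid_def)

lemma matroid_rank_mono: "matroid E rk \<Longrightarrow> X \<subseteq> Y \<Longrightarrow> Y \<subseteq> E \<Longrightarrow> rk X \<le> rk Y"
  by (simp add: matroid_def)

lemma matroid_rank_submodular:
  "matroid E rk \<Longrightarrow> X \<subseteq> E \<Longrightarrow> Y \<subseteq> E \<Longrightarrow> rk (X \<union> Y) + rk (X \<inter> Y) \<le> rk X + rk Y"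
  by (simp add: matroid_def)

text \<open>Submodularity gives \<open>card B \<le> rk X + rk (B - X)\<close>, and each rank is at
  most the cardinality, so equality holds throughout.\<close>

lemma indep_subset:
  assumes M: "matroid E rk" and "indep E rk B" "X \<subseteq> B"
  shows "indep E rk X"
proof -
  have B: "B \<subseteq> E" "rk B = card B" "X \<subseteq> E" "finite B"
    using assms by (auto simp: indep_def matroid_def intro: finite_subset)
  have "rk (X \<union> (B - X)) \<le> rk X + rk (B - X)"
    using matroid_rank_submodular[OF M, of X "B - X"] B by (meson Diff_subset add_leD1 order_trans)
  moreover have "X \<union> (B - X) = B" using \<open>X \<subseteq> B\<close> by blast
  moreover have "rk (B - X) \<le> card (B - X)" "rk X \<le> card X"
    using matroid_rank_le_card[OF M, of "B - X"] matroid_rank_le_card[OF M, of X] B by auto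
  moreover have "card B = card X + card (B - X)"
    using B \<open>X \<subseteq> B\<close> by (metis card_Diff_subset card_mono finite_subset le_add_diff_inverse)
  ultimately show ?thesis
    using B by (auto simp: indep_def)
qed

lemma card_indep_Int_le:
  assumes M: "matroid E rk" and "indep E rk B" "S \<subseteq> E"
  shows "card (B \<inter> S) \<le> rk S"
  using indep_subset[OF M assms(2), of "B \<inter> S"] matroid_rank_mono[OF M, of "B \<inter> S" S] assms(3)
  by (auto simp: indep_def)

text \<open>If no single element of \<open>S\<close> raised the rank of \<open>A\<close>,
  submodularity would let all of \<open>S\<close> be added one by one without raising it.\<close>

lemma rank_augment:
  assumes M: "matroid E rk" and "A \<subseteq> E" "S \<subseteq> E" "rk A < rk S"
  shows "\<exists>b\<in>S. rk A < rk (insert b A)"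
proof (rule ccontr)
  assume "\<not> ?thesis"
  then have *: "rk (insert b A) \<le> rk A" if "b \<in> S" for b
    using that by force
  have "finite S" using assms by (auto simp: matroid_def intro: finite_subset)
  then have "rk (A \<union> S) \<le> rk A"
    using \<open>S \<subseteq> E\<close> *
  proof (induction S rule: finite_induct)
    case (insert b S)
    have "rk ((A \<union> S) \<union> insert b A) + rk ((A \<union> S) \<inter> insert b A) \<le> rk (A \<union> S) + rk (insert b A)"
      using insert.prems assms(2) by (intro matroid_rank_submodular[OF M]) auto
    moreover have "(A \<union> S) \<union> insert b A = A \<union> insert b S" by blast
    moreover have "rk A \<le> rk ((A \<union> S) \<inter> insert b A)"
      using insert.prems assms(2) by (intro matroid_rank_mono[OF M]) auto
    ultimately show ?case using insert by force
  qed simp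
  moreover have "rk S \<le> rk (A \<union> S)"
    using assms by (intro matroid_rank_mono[OF M]) auto
  ultimately show False using assms(4) by simp
qed

text \<open>The greedy algorithm along a chain: each new element comes from the smallest member
  whose rank exceeds the number of elements chosen so far. This one ordered basis serves all members
  of \<open>C\<close>.\<close>

lemma greedy_basis:
  assumes M: "matroid E rk" and C: "subset.chain (Pow E) C"
  obtains bs where "distinct bs" "length bs = rk E" "indep E rk (set bs)"
    "\<And>S. S \<in> C \<Longrightarrow> set (take (rk S) bs) \<subseteq> S"
proof -
  have "finite E" using M by (simp add: matroid_def)
  \<comment> \<open>While \<open>k \<le> rk S\<close>, \<open>take\<close> returns the whole list,
    so the invariant says that everything chosen so far lies in \<open>S\<close>.\<close>
  have "k \<le> rk E \<Longrightarrow> \<exists>bs. distinct bs \<and> length bs = k \<and> indep E rk (set bs) \<and>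
    (\<forall>S\<in>C. set (take (rk S) bs) \<subseteq> S)" for k
  proof (induction k)
    case 0
    then show ?case
      using matroid_rank_le_card[OF M, of "{}"] by (simp add: indep_def)
  next
    case (Suc k)
    then obtain bs where bs: "distinct bs" "length bs = k" "indep E rk (set bs)"
      "\<forall>S\<in>C. set (take (rk S) bs) \<subseteq> S" by auto
    \<comment> \<open>\<open>E\<close> has rank above \<open>k\<close> too; inserting it makes
      \<open>D\<close> nonempty, so \<open>\<Inter>D\<close> is its least member.\<close>
    define D where "D = insert E {S\<in>C. k < rk S}"
    have "D \<subseteq> Pow E" using C by (auto simp: D_def subset_chain_def)
    have "subset.chain (Pow E) D"
      using C by (auto simp: D_def subset_chain_def)
    then have Dmin: "\<Inter>D \<in> D"
      using \<open>D \<subseteq> Pow E\<close> \<open>finite E\<close> by (intro Inter_in_chain) (auto simp: D_def intro: finite_subset)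
    have "rk (set bs) < rk (\<Inter>D)"
      using Dmin Suc.prems bs by (auto simp: D_def indep_def distinct_card)
    moreover have "set bs \<subseteq> E" "\<Inter>D \<subseteq> E"
      using bs Dmin \<open>D \<subseteq> Pow E\<close> by (auto simp: indep_def)
    ultimately obtain b where b: "b \<in> \<Inter>D" "rk (set bs) < rk (insert b (set bs))"
      using rank_augment[OF M] by metis
    have "b \<notin> set bs" using b by (auto simp: insert_absorb)
    have "b \<in> E" using b by (simp add: D_def)
    have "indep E rk (set (bs @ [b]))"
      using matroid_rank_le_card[OF M, of "insert b (set bs)"] b bs \<open>b \<in> E\<close> \<open>b \<notin> set bs\<close>
      by (auto simp: indep_def)
    moreover have "set (take (rk S) (bs @ [b])) \<subseteq> S" if "S \<in> C" for S
    proof (cases "rk S \<le> k")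
      case True
      then show ?thesis using bs that by simp
    next
      case False
      then have "S \<in> D" using that by (simp add: D_def)
      then have "b \<in> S" using b by blast
      moreover have "set bs \<subseteq> S" using bs(2,4) that False by (metis nat_le_linear take_all)
      ultimately show ?thesis using set_take_subset[of "rk S" "bs @ [b]"] by auto
    qed
    ultimately show ?case
      using bs \<open>b \<notin> set bs\<close> by (intro exI[of _ "bs @ [b]"]) auto
  qed
  then show ?thesis using that by blast
qed

text \<open>Prefixes of an ordered basis are independent, and their sizes force strict inclusion.
  List index \<open>i\<close> holds the prefix of length \<open>Suc i\<close>.\<close>

lemma prefixes_in_truncation_flags:
  assumes M: "matroid E rk" and bs: "distinct bs" "length bs = rk E" "indep E rk (set bs)"
  shows "map (\<lambda>i. set (take (Suc i) bs)) [0..<rk E] \<in> truncation_flags E rk"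
proof -
  have card: "card (set (take i bs)) = i" if "i \<le> rk E" for i
    using bs that by (simp add: distinct_card)
  have "indep E rk (set (take i bs))" for i
    using indep_subset[OF M bs(3)] set_take_subset by metis
  then have "set (take i bs) \<in> truncation_bases E rk i" if "i \<le> rk E" for i
    using card[OF that] by (simp add: truncation_bases_def)
  moreover have "set (take (Suc i) bs) \<subset> set (take (Suc j) bs)" if "i < j" "j < rk E" for i j
  proof -
    have "set (take (Suc i) bs) \<subseteq> set (take (Suc j) bs)"
      using that by (intro set_take_subset_set_take) simp
    then show ?thesis using card[of "Suc i"] card[of "Suc j"] that by force
  qed
  ultimately show ?thesis
    by (auto simp: truncation_flags_def sorted_wrt_iff_nth_less)
qed

lemma flag_vec_sum: "(\<Sum>a\<in>S. flag_vec B $ a) = (\<Sum>T\<leftarrow>B. real (card (T \<inter> S)))"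
proof -
  have "(\<Sum>a\<in>S. set_vec T $ a) = real (card (T \<inter> S))" for T
  proof -
    have "set_vec T $ a = of_bool (a \<in> T)" for a
      by (simp add: set_vec_def axis_def)
    then show ?thesis by (simp add: Int_commute)
  qed
  then show ?thesis
    by (induction B) (simp_all add: flag_vec_def sum.distrib)
qed

lemma truncation_flag_sum:
  assumes "B \<in> truncation_flags E rk"
  shows "(\<Sum>a\<in>S. flag_vec B $ a) = (\<Sum>i=1..rk E. real (card (B ! (i - 1) \<inter> S)))"
proof -
  have "(\<Sum>a\<in>S. flag_vec B $ a) = (\<Sum>i<rk E. real (card (B ! i \<inter> S)))"
    using assms
    by (simp add: flag_vec_sum sum_list_sum_nth truncation_flags_def atLeast0LessThan)
  also have "\<dots> = (\<Sum>i=1..rk E. real (card (B ! (i - 1) \<inter> S)))"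
    by (rule sum.reindex_bij_witness[of _ "\<lambda>i. i - 1" Suc]) auto
  finally show ?thesis .
qed

text \<open>The member of size \<open>i\<close> of a flag meets \<open>S\<close> in an independent
  set, hence in at most \<open>min i (rk S)\<close> elements. The prefixes of a greedy basis attain
  this for all members of a chain.\<close>

lemma gen_permutohedron_flag_polytope:
  assumes M: "matroid E rk"
  shows "gen_permutohedron E (\<lambda>S. \<Sum>i=1..rk E. real (min i (rk S))) (flag_polytope E rk)"
  unfolding flag_polytope_def
proof (rule gen_permutohedron_convex_hull)
  have fl: "indep E rk (B ! (i - 1))" "B ! (i - 1) \<subseteq> E" "card (B ! (i - 1)) = i"
    if "B \<in> truncation_flags E rk" "i \<in> {1..rk E}" for B i
    using that by (auto simp: truncation_flags_def truncation_bases_def indep_def)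
  have "truncation_flags E rk \<subseteq> {B. set B \<subseteq> UNIV \<and> length B = rk E}"
    by (auto simp: truncation_flags_def)
  then have "finite (truncation_flags E rk)"
    using finite_lists_length_eq[of UNIV] by (rule finite_subset) simp
  then show "finite (flag_vec ` truncation_flags E rk)" by simp
  show "(\<Sum>a\<in>S. x $ a) \<le> (\<Sum>i=1..rk E. real (min i (rk S)))"
    if "x \<in> flag_vec ` truncation_flags E rk" "S \<subseteq> E" for x S
  proof -
    obtain B where B: "B \<in> truncation_flags E rk" "x = flag_vec B" using \<open>x \<in> _\<close> by blast
    have "card (B ! (i - 1) \<inter> S) \<le> min i (rk S)" if "i \<in> {1..rk E}" for i
      using card_indep_Int_le[OF M fl(1)[OF B(1) that] \<open>S \<subseteq> E\<close>] fl(3)[OF B(1) that]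
        card_mono[of "B ! (i - 1)" "B ! (i - 1) \<inter> S"] by auto
    then show ?thesis
      unfolding B(2) truncation_flag_sum[OF B(1)] by (intro sum_mono of_nat_mono)
  qed
  show "(\<Sum>a\<in>E. x $ a) = (\<Sum>i=1..rk E. real (min i (rk E)))"
    if "x \<in> flag_vec ` truncation_flags E rk" for x
  proof -
    obtain B where B: "B \<in> truncation_flags E rk" "x = flag_vec B" using \<open>x \<in> _\<close> by blast
    have "card (B ! (i - 1) \<inter> E) = min i (rk E)" if "i \<in> {1..rk E}" for i
      using fl[OF B(1) that] that by (simp add: Int_absorb2)
    then show ?thesis
      unfolding B(2) truncation_flag_sum[OF B(1)] by simp
  qed
  show "x $ a = 0" if "x \<in> flag_vec ` truncation_flags E rk" "a \<notin> E" for x a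
  proof -
    obtain B where B: "B \<in> truncation_flags E rk" "x = flag_vec B" using \<open>x \<in> _\<close> by blast
    \<comment> \<open>The singleton \<open>{a}\<close> turns the sum formula into a formula for the
      coordinate at \<open>a\<close>.\<close>
    have "card (B ! (i - 1) \<inter> {a}) = 0" if "i \<in> {1..rk E}" for i
      using fl(2)[OF B(1) that] \<open>a \<notin> E\<close> by auto
    then show ?thesis
      using truncation_flag_sum[OF B(1), of "{a}"] B(2) by simp
  qed
  show "\<exists>x\<in>flag_vec ` truncation_flags E rk. \<forall>S\<in>C. (\<Sum>a\<in>S. x $ a) = (\<Sum>i=1..rk E. real (min i (rk S)))"
    if C: "subset.chain (Pow E) C" for C
  proof -
    obtain bs where bs: "distinct bs" "length bs = rk E" "indep E rk (set bs)"
      "\<And>S. S \<in> C \<Longrightarrow> set (take (rk S) bs) \<subseteq> S"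
      using greedy_basis[OF M C] by blast
    define B where "B = map (\<lambda>i. set (take (Suc i) bs)) [0..<rk E]"
    have B: "B \<in> truncation_flags E rk"
      unfolding B_def using prefixes_in_truncation_flags[OF M bs(1-3)] .
    have "card (B ! (i - 1) \<inter> S) = min i (rk S)" if "S \<in> C" "i \<in> {1..rk E}" for S i
    proof -
      have "S \<subseteq> E" using C that by (auto simp: subset_chain_def)
      have B_nth: "B ! (i - 1) = set (take i bs)" using that by (auto simp: B_def)
      \<comment> \<open>The greedy property supplies the lower bound: these elements belong both to
        the flag member and to \<open>S\<close>.\<close>
      have "set (take (min i (rk S)) bs) \<subseteq> set (take i bs) \<inter> S"
        using bs(4)[OF that(1)] set_take_subset_set_take[of "min i (rk S)" "rk S" bs]
          set_take_subset_set_take[of "min i (rk S)" i bs] by auto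
      then have "card (set (take (min i (rk S)) bs)) \<le> card (set (take i bs) \<inter> S)"
        by (intro card_mono) auto
      then have "min i (rk S) \<le> card (B ! (i - 1) \<inter> S)"
        using bs(1,2) that(2) unfolding B_nth by (auto simp: distinct_card)
      moreover have "card (B ! (i - 1) \<inter> S) \<le> i"
        using fl(3)[OF B that(2)] card_mono[of "B ! (i - 1)" "B ! (i - 1) \<inter> S"] by auto
      moreover have "card (B ! (i - 1) \<inter> S) \<le> rk S"
        using card_indep_Int_le[OF M fl(1)[OF B that(2)] \<open>S \<subseteq> E\<close>] .
      ultimately show ?thesis by simp
    qed
    then have "(\<Sum>a\<in>S. flag_vec B $ a) = (\<Sum>i=1..rk E. real (min i (rk S)))" if "S \<in> C" for S
      unfolding truncation_flag_sum[OF B] using that by simp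
    then show ?thesis using B by blast
  qed
qed

section \<open>The signed gamma invariant\<close>

text \<open>In the constant term in \<open>y\<close>, each factor \<open>var_y - 1\<close> becomes
  -1, and the power of \<open>var_x - 1\<close> is expanded binomially.\<close>

lemma tutte_coeff_0:
  assumes M: "matroid S rk"
  shows "tutte_coeff S rk i 0 = (-1) ^ (rk S + i) * (\<Sum>A\<in>Pow S. (-1) ^ card A * int ((rk S - rk A) choose i))"
proof -
  have "coeff (coeff ((var_x - 1) ^ (rk S - rk A) * (var_y - 1) ^ (card A - rk A)) 0) i =
      (-1) ^ (rk S + i) * ((-1) ^ card A * int ((rk S - rk A) choose i))" if "A \<in> Pow S" for A
  proof -
    define n where "n = rk S - rk A"
    have rk: "rk A \<le> card A" "rk A \<le> rk S"
      using that matroid_rank_le_card[OF M] matroid_rank_mono[OF M] by auto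
    have x: "coeff (var_x - 1) 0 = [:-1, 1:]" and y: "coeff (var_y - 1) 0 = -1"
      by (simp_all add: var_x_def var_y_def one_pCons)
    have m1: "((-1) ^ k :: int poly) = [:(-1) ^ k:]" for k
      by (induction k) (simp_all add: one_pCons)
    have "coeff (coeff ((var_x - 1) ^ n * (var_y - 1) ^ (card A - rk A)) 0) i
        = coeff ([:-1, 1:] ^ n) i * (-1) ^ (card A - rk A)"
      by (simp only: coeff_mult_0 coeff_0_power x y m1) (simp add: mult.commute)
    also have "coeff ([:-1, 1:] ^ n) i = (-1) ^ (n + i) * int (n choose i)"
    proof (cases "i \<le> n")
      case True
      then have "(-1 :: int) ^ (n - i) = (-1) ^ (n + i)" by (simp add: minus_one_power_iff)
      with True show ?thesis by (simp add: coeff_linear_poly_power)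
    next
      \<comment> \<open>Beyond the degree, both the coefficient and the binomial vanish.\<close>
      case False
      then show ?thesis
        using degree_power_le[of "[:-1, 1::int:]" n] by (simp add: coeff_eq_0 binomial_eq_0)
    qed
    also have "(-1) ^ (n + i) * int (n choose i) * (-1) ^ (card A - rk A)
        = (-1) ^ (rk S + i) * ((-1) ^ card A * int (n choose i))"
    proof -
      \<comment> \<open>The exponents differ by \<open>2 * rk A\<close>.\<close>
      have "(-1 :: int) ^ (n + i + (card A - rk A)) = (-1) ^ (rk S + i + card A)"
        using rk by (auto simp: n_def minus_one_power_iff)
      then show ?thesis by (simp add: power_add mult_ac)
    qed
    finally show ?thesis by (simp add: n_def)
  qed
  then show ?thesis
    by (simp add: tutte_coeff_def tutte_def coeff_sum sum_distrib_left)
qed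

text \<open>The coefficients for exponents 2 and 1 carry opposite signs, so their difference adds
  the two binomials, which Pascal's rule merges. The sign in the signed invariant cancels the
  remaining \<open>(-1) ^ rk S\<close>.\<close>

lemma signed_gamma_eq:
  assumes M: "matroid S rk"
  shows "signed_gamma S rk = (\<Sum>A\<in>Pow S. (-1) ^ card A * int (Suc (rk S - rk A) choose 2))"
proof -
  have "(-1 :: int) ^ rk S * (-1) ^ rk S = 1"
    by (simp flip: power_add)
  then have sq: "(-1 :: int) ^ rk S * ((-1) ^ rk S * x) = x" for x
    by (metis mult.assoc mult_1)
  have "int (Suc n choose 2) = int (n choose 2) + int (n choose 1)" for n
    by (simp add: numeral_2_eq_2)
  then show ?thesis
    unfolding signed_gamma_def gamma_inv_def tutte_coeff_0[OF M]
    by (simp add: sq distrib_left sum.distrib power_add right_diff_distrib)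
qed

lemma signed_gamma_contract_eq:
  assumes M: "matroid E rk" and "I \<subseteq> E"
  shows "signed_gamma_contract E rk I =
    (\<Sum>A\<in>Pow (E - I). (-1) ^ card A * int (Suc (rk E - rk (A \<union> I)) choose 2))"
proof -
  have "contract_rank rk I (E - I) - contract_rank rk I A = rk E - rk (A \<union> I)" if "A \<subseteq> E - I" for A
  proof -
    have "E - I \<union> I = E" using \<open>I \<subseteq> E\<close> by blast
    \<comment> \<open>This keeps the natural-number subtractions from truncating, so
      \<open>rk I\<close> cancels.\<close>
    moreover have "rk I \<le> rk (A \<union> I)"
      using that \<open>I \<subseteq> E\<close> by (intro matroid_rank_mono[OF M]) auto
    ultimately show ?thesis by (simp add: contract_rank_def)
  qed
  then show ?thesis
    unfolding signed_gamma_contract_def signed_gamma_eq[OF matroid_contract[OF assms]] by simp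
qed

section \<open>Moebius inversion over supersets\<close>

lemma sum_Pow_minus_one_power_card:
  "finite X \<Longrightarrow> (\<Sum>A\<in>Pow X. (-1) ^ card A) = (of_bool (X = {}) :: 'b::ring_1)"
  using card_subsupersets_even_odd[of X "{}"]
  by (cases "X = {}") (simp_all add: sum_alternating_cancels psubset_eq)

text \<open>Grouping by \<open>T = A \<union> I\<close>, the set \<open>A\<close> runs over all
  subsets of \<open>T - S\<close>, and their alternating sum vanishes unless
  \<open>T = S\<close>.\<close>

lemma sum_supersets_alternating:
  fixes g :: "'a set \<Rightarrow> 'b::comm_ring_1"
  assumes "finite E" "S \<subseteq> E"
  shows "(\<Sum>I | S \<subseteq> I \<and> I \<subseteq> E. \<Sum>A\<in>Pow (E - I). (-1) ^ card A * g (A \<union> I)) = g S"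
proof -
  have fin: "finite {I. S \<subseteq> I \<and> I \<subseteq> E}" "finite (Pow X)" if "X \<subseteq> E" for X
    using assms that by (auto intro: finite_subset)
  have "(\<Sum>I | S \<subseteq> I \<and> I \<subseteq> E. \<Sum>A\<in>Pow (E - I). (-1) ^ card A * g (A \<union> I))
      = (\<Sum>T | S \<subseteq> T \<and> T \<subseteq> E. \<Sum>A\<in>Pow (T - S). (-1) ^ card A * g T)"
    using assms fin
    \<comment> \<open>\<open>A\<close> is disjoint from \<open>I\<close>, so \<open>I\<close> is
      recovered as \<open>T - A\<close>.\<close>
    by (simp add: sum.Sigma, intro sum.reindex_bij_witness
        [of _ "\<lambda>(T, A). (T - A, A)" "\<lambda>(I, A). (A \<union> I, A)"]) auto
  also have "\<dots> = (\<Sum>T | S \<subseteq> T \<and> T \<subseteq> E. of_bool (T = S) * g T)"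
  proof (rule sum.cong[OF refl])
    fix T assume "T \<in> {T. S \<subseteq> T \<and> T \<subseteq> E}"
    moreover from this have "finite (T - S)" using assms finite_subset by blast
    ultimately show "(\<Sum>A\<in>Pow (T - S). (-1) ^ card A * g T) = of_bool (T = S) * g T"
      by (auto simp: sum_Pow_minus_one_power_card simp flip: sum_distrib_right)
  qed
  also have "\<dots> = g S"
    using assms fin by simp
  finally show ?thesis .
qed

lemma sum_signed_gamma_contract:
  assumes M: "matroid E rk" and "S \<subseteq> E"
  shows "(\<Sum>I | S \<subseteq> I \<and> I \<subseteq> E. signed_gamma_contract E rk I) = int (Suc (rk E - rk S) choose 2)"
  using sum_supersets_alternating[of E S "\<lambda>T. int (Suc (rk E - rk T) choose 2)"] assms
  by (simp add: signed_gamma_contract_eq[OF M] matroid_def)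

text \<open>Replacing \<open>i\<close> by \<open>min i k\<close> loses \<open>i - k\<close> for each
  \<open>i > k\<close>, in total the triangular number of \<open>r - k\<close>.\<close>

lemma sum_min_eq_choose:
  assumes "k \<le> r"
  shows "(\<Sum>i=1..r. real (min i k)) = real (Suc r choose 2) - real (Suc (r - k) choose 2)"
  using assms
proof (induction r)
  case (Suc r)
  show ?case
  \<comment> \<open>The induction hypothesis covers only \<open>k \<le> r\<close>; in the boundary
    case the sum is a plain triangular number.\<close>
  proof (cases "k = Suc r")
    case True
    have "(\<Sum>i=1..n. real (min i n)) = real (Suc n choose 2)" for n
    proof -
      have "(\<Sum>i=1..n. real (min i n)) = (\<Sum>i=1..n. real i)" by (intro sum.cong) auto
      also have "\<dots> = real (Suc n choose 2)"
        by (induction n) (simp_all add: numeral_2_eq_2)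
      finally show ?thesis .
    qed
    then show ?thesis using True by (simp add: numeral_2_eq_2)
  next
    case False
    then show ?thesis
      using Suc by (simp add: numeral_2_eq_2 Suc_diff_le)
  qed
qed simp

text \<open>A set \<open>S \<subseteq> E\<close> misses \<open>E - I\<close> exactly when
  \<open>S \<subseteq> I\<close>. The right side is thus the sum over all \<open>I\<close> minus the
  sum over the supersets of \<open>S\<close>, both known by inversion.\<close>

lemma flag_rank_sum_eq_signed_gamma_sum:
  assumes M: "matroid E rk" and "S \<subseteq> E"
  shows "(\<Sum>i=1..rk E. real (min i (rk S))) =
    (\<Sum>I\<in>Pow E. real_of_int (signed_gamma_contract E rk I) * of_bool (S \<inter> (E - I) \<noteq> {}))"
proof -
  let ?\<gamma> = "\<lambda>I. real_of_int (signed_gamma_contract E rk I)"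
  have fin: "finite (Pow E)" and r0: "rk {} = 0"
    using M matroid_rank_le_card[OF M, of "{}"] by (auto simp: matroid_def)
  have upper: "(\<Sum>I | T \<subseteq> I \<and> I \<subseteq> E. ?\<gamma> I) = real (Suc (rk E - rk T) choose 2)" if "T \<subseteq> E" for T
    using sum_signed_gamma_contract[OF M that] by (metis of_int_of_nat_eq of_int_sum)
  have "(\<Sum>I\<in>Pow E. ?\<gamma> I * of_bool (S \<inter> (E - I) \<noteq> {}))
      = (\<Sum>I\<in>Pow E. ?\<gamma> I - (if S \<subseteq> I then ?\<gamma> I else 0))"
    using \<open>S \<subseteq> E\<close> by (intro sum.cong) auto
  also have "\<dots> = (\<Sum>I\<in>Pow E. ?\<gamma> I) - (\<Sum>I | S \<subseteq> I \<and> I \<subseteq> E. ?\<gamma> I)"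
    using fin by (auto simp: sum_subtractf sum.If_cases intro!: sum.cong)
  also have "(\<Sum>I\<in>Pow E. ?\<gamma> I) = real (Suc (rk E) choose 2)"
    using upper[of "{}"] r0 by (simp add: Pow_def)
  also have "(\<Sum>I | S \<subseteq> I \<and> I \<subseteq> E. ?\<gamma> I) = real (Suc (rk E - rk S) choose 2)"
    using upper \<open>S \<subseteq> E\<close> .
  finally show ?thesis
    using sum_min_eq_choose[of "rk S" "rk E"] matroid_rank_mono[OF M \<open>S \<subseteq> E\<close>] by simp
qed

theorem theorem5p4:
  fixes E :: "'a::finite set" and rk :: "'a set \<Rightarrow> nat"
  assumes "matroid E rk"
  shows "flag_polytope E rk
      + (\<Sum>I | I \<subseteq> E \<and> signed_gamma_contract E rk I < 0.
           (\<lambda>x. (- real_of_int (signed_gamma_contract E rk I)) *\<^sub>R x) ` simplex_on (E - I))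
      = (\<Sum>I | I \<subseteq> E \<and> signed_gamma_contract E rk I > 0.
           (\<lambda>x. real_of_int (signed_gamma_contract E rk I) *\<^sub>R x) ` simplex_on (E - I))"
proof -
  let ?\<gamma> = "signed_gamma_contract E rk"
  let ?N = "{I. I \<subseteq> E \<and> ?\<gamma> I < 0}" and ?P = "{I. I \<subseteq> E \<and> ?\<gamma> I > 0}"
  let ?h = "\<lambda>I S. of_bool (S \<inter> (E - I) \<noteq> {}) :: real"
  \<comment> \<open>\<open>simplex_on {}\<close> is empty, so the term \<open>I = E\<close> must not occur in either sum.\<close>
  have "?\<gamma> E = 0"
    by (simp add: signed_gamma_contract_eq[OF assms])
  then have simplex: "gen_permutohedron E (?h I) (simplex_on (E - I))" if "I \<subseteq> E" "?\<gamma> I \<noteq> 0" for I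
    using that by (intro gen_permutohedron_simplex_on) auto
  have neg: "gen_permutohedron E (\<lambda>S. \<Sum>I\<in>?N. - real_of_int (?\<gamma> I) * ?h I S)
      (\<Sum>I\<in>?N. (\<lambda>x. (- real_of_int (?\<gamma> I)) *\<^sub>R x) ` simplex_on (E - I))"
    by (intro gen_permutohedron_sum gen_permutohedron_scale simplex) auto
  have pos: "gen_permutohedron E (\<lambda>S. \<Sum>I\<in>?P. real_of_int (?\<gamma> I) * ?h I S)
      (\<Sum>I\<in>?P. (\<lambda>x. real_of_int (?\<gamma> I) *\<^sub>R x) ` simplex_on (E - I))"
    by (intro gen_permutohedron_sum gen_permutohedron_scale simplex) auto
  have "(\<Sum>i=1..rk E. real (min i (rk S))) + (\<Sum>I\<in>?N. - real_of_int (?\<gamma> I) * ?h I S)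
      = (\<Sum>I\<in>?P. real_of_int (?\<gamma> I) * ?h I S)" if "S \<subseteq> E" for S
  proof -
    \<comment> \<open>Only the sets with nonzero coefficient contribute; the negative ones then move
      to the other side.\<close>
    have "(\<Sum>I\<in>Pow E. real_of_int (?\<gamma> I) * ?h I S) = (\<Sum>I\<in>?P \<union> ?N. real_of_int (?\<gamma> I) * ?h I S)"
      by (rule sum.mono_neutral_right) auto
    also have "\<dots> = (\<Sum>I\<in>?P. real_of_int (?\<gamma> I) * ?h I S) + (\<Sum>I\<in>?N. real_of_int (?\<gamma> I) * ?h I S)"
      by (rule sum.union_disjoint) auto
    finally show ?thesis
      using flag_rank_sum_eq_signed_gamma_sum[OF assms that] by (simp add: sum_negf)
  qed
  then have "gen_permutohedron E (\<lambda>S. \<Sum>I\<in>?P. real_of_int (?\<gamma> I) * ?h I S) (flag_polytope E rk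
      + (\<Sum>I\<in>?N. (\<lambda>x. (- real_of_int (?\<gamma> I)) *\<^sub>R x) ` simplex_on (E - I)))"
    by (rule gen_permutohedron_cong)
      (use gen_permutohedron_plus[OF gen_permutohedron_flag_polytope[OF assms] neg] in auto)
  then show ?thesis
    using pos gen_permutohedron_unique by blast
qed

end
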